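(* Let $d\ge 1$ and $r\ge d$ be integers, and let $x_1,\dots,x_d$ be nonnegative integers with $x_1+\cdots+x_d=r$. Let $C$ be a set of $r$ vertices. For a simple graph $G$ on vertex set $C$, let $S(G)$ (the "sun" centered at $G$) be the graph obtained from $G$ by attaching to each vertex of $C$ one new pendant edge, the $r$ pendant edges having distinct new end vertices. Fix a coloring of the $r$ pendant edges with colors $1,\dots,d$ in which exactly $x_i$ pendant edges receive color $i$ for each $i$. Then there exists a $(d-1)$-regular simple graph $G$ on $C$ such that this coloring of the pendant edges extends to a proper edge coloring of $S(G)$ with the $d$ colors $1,\dots,d$ (equivalently, $S(G)$ is class I with the given pendant colors) if and only if $x_1,\dots,x_d$ and $r$ all have the same parity and, in case this common parity is odd, $d$ is also odd. If the condition fails, no $(d-1)$-regular simple graph $G$ on $C$ has this property.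
   Context: A proper edge coloring assigns colors to edges so that edges sharing an end vertex get different colors. A multigraph is called class I if its chromatic index (minimum number of colors in a proper edge coloring) equals its maximum valency. Note that for $(d-1)$-regular $G$, the graph $S(G)$ has maximum valency $d$. *)

theory Defs
  imports Main "HOL-Library.FuncSet"
begin

datatype 'a ugraph = UGraph (verts: "'a set") (edges: "'a set set")

definition simple_graph :: "'a ugraph \<Rightarrow> bool" where
  "simple_graph G \<longleftrightarrow> finite (verts G) \<and> (\<forall>e\<in>edges G. e \<subseteq> verts G \<and> card e = 2)"

definition valency :: "'a ugraph \<Rightarrow> 'a \<Rightarrow> nat" where
  "valency G v = card {e \<in> edges G. v \<in> e}"

definition regular :: "nat \<Rightarrow> 'a ugraph \<Rightarrow> bool" where
  "regular k G \<longleftrightarrow> (\<forall>v\<in>verts G. valency G v = k)"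

text \<open>Only meaningful for a nonempty finite vertex set.\<close>

definition max_valency :: "'a ugraph \<Rightarrow> nat" where
  "max_valency G = Max (valency G ` verts G)"

definition proper_edge_coloring :: "'a ugraph \<Rightarrow> nat set \<Rightarrow> ('a set \<Rightarrow> nat) \<Rightarrow> bool" where
  "proper_edge_coloring G K f \<longleftrightarrow> f \<in> edges G \<rightarrow> K \<and>
     (\<forall>e\<in>edges G. \<forall>e'\<in>edges G. e \<noteq> e' \<and> e \<inter> e' \<noteq> {} \<longrightarrow> f e \<noteq> f e')"

definition chromatic_index :: "'a ugraph \<Rightarrow> nat" where
  "chromatic_index G = (LEAST k. \<exists>f. proper_edge_coloring G {1..k} f)"

definition class_one :: "'a ugraph \<Rightarrow> bool" where
  "class_one G \<longleftrightarrow> chromatic_index G = max_valency G"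

text \<open>In the sun, \<open>Inl v\<close> is the original vertex \<open>v\<close> and \<open>Inr v\<close> the new end vertex of
  the pendant edge attached to it. The pendant edges depend on the vertex set only.\<close>

definition pendant_edge :: "'a \<Rightarrow> ('a + 'a) set" where
  "pendant_edge v = {Inl v, Inr v}"

definition pendant_edges :: "'a set \<Rightarrow> ('a + 'a) set set" where
  "pendant_edges C = pendant_edge ` C"

definition sun :: "'a ugraph \<Rightarrow> ('a + 'a) ugraph" where
  "sun G = UGraph (Inl ` verts G \<union> Inr ` verts G)
                  ((`) Inl ` edges G \<union> pendant_edges (verts G))"

text \<open>The coloring \<open>c\<close> of the pendant edges extends to a proper edge coloring of the sun
  centered at \<open>G\<close> with colors in \<open>K\<close>; values of \<open>c\<close> off the pendant edges are irrelevant.\<close>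

definition pendant_coloring_extends ::
    "'a ugraph \<Rightarrow> nat set \<Rightarrow> (('a + 'a) set \<Rightarrow> nat) \<Rightarrow> bool" where
  "pendant_coloring_extends G K c \<longleftrightarrow>
     (\<exists>f. proper_edge_coloring (sun G) K f \<and> (\<forall>e\<in>pendant_edges (verts G). f e = c e))"

definition sun_class_one_with :: "'a ugraph \<Rightarrow> (('a + 'a) set \<Rightarrow> nat) \<Rightarrow> bool" where
  "sun_class_one_with G c \<longleftrightarrow>
     class_one (sun G) \<and> pendant_coloring_extends G {1..chromatic_index (sun G)} c"

end

theory Submission imports Defs "HOL-Combinatorics.Cycles" begin

text \<open>A coloring of the sun is encoded by involutions \<open>m 1, ..., m d\<close> of \<open>C\<close>, one for each
  color. Necessity of the parity condition holds because the edges of color \<open>i\<close> pair off the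
  \<open>r - x i\<close> vertices whose pendant edge has another color. For sufficiency, start from a
  coloring in which one color \<open>a\<close> has as many pendant edges as possible: every other color has
  none if \<open>r\<close> is even (disjoint perfect matchings of the complete graph) and one if \<open>r\<close> is odd
  (reflections of the integers modulo \<open>r\<close>). If color \<open>i\<close> has more pendant edges than color \<open>j\<close>,
  some Kempe path in these two colors begins and ends with pendant edges of color \<open>i\<close>; swapping
  the colors along it moves two pendant edges from \<open>i\<close> to \<open>j\<close>. Such moves reach every
  distribution of the required parity in which color \<open>a\<close> is a most frequent one.\<close>

section \<open>Involutions as color classes\<close>

definition involution_on :: "'a set \<Rightarrow> ('a \<Rightarrow> 'a) \<Rightarrow> bool" where
  "involution_on C f \<longleftrightarrow> (\<forall>v. f (f v) = v) \<and> (\<forall>v. v \<notin> C \<longrightarrow> f v = v)"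

definition fixed_points :: "'a set \<Rightarrow> ('a \<Rightarrow> 'a) \<Rightarrow> 'a set" where
  "fixed_points C f = {v \<in> C. f v = v}"

text \<open>The involution \<open>m i\<close> exchanges the two ends of every edge of color \<open>i\<close> between vertices
  of \<open>C\<close> and fixes precisely the vertices whose pendant edge has color \<open>i\<close>.\<close>

definition sun_system :: "nat set \<Rightarrow> 'a set \<Rightarrow> (nat \<Rightarrow> 'a \<Rightarrow> 'a) \<Rightarrow> bool" where
  "sun_system K C m \<longleftrightarrow> (\<forall>i\<in>K. involution_on C (m i)) \<and>
     (\<forall>v\<in>C. inj_on (\<lambda>i. m i v) K \<and> (\<exists>i\<in>K. m i v = v))"

lemma involution_on_involutive: "involution_on C f \<Longrightarrow> f (f v) = v"
  by (simp add: involution_on_def)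

lemma involution_on_mem: "involution_on C f \<Longrightarrow> f v \<in> C \<longleftrightarrow> v \<in> C"
  by (metis involution_on_def)

lemma involution_on_permutes: "involution_on C f \<Longrightarrow> f permutes C"
  unfolding involution_on_def permutes_def by metis

subsection \<open>Kempe components of two involutions\<close>

context
  fixes C :: "'a set" and p q t :: "'a \<Rightarrow> 'a"
  assumes fin: "finite C" and p: "involution_on C p" and q: "involution_on C q"
  defines "t \<equiv> q \<circ> p"
begin

private lemma t_permutes: "t permutes C"
  unfolding t_def using p q by (intro permutes_compose involution_on_permutes)

private lemma t_permutation: "permutation t"
  using t_permutes fin permutation_permutes by blast

private lemma funpow_t_eq_iff: "(t ^^ k) u = (t ^^ k) w \<longleftrightarrow> u = w"
  using inj_fn[OF permutes_inj[OF t_permutes]] by (metis injD)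

private lemma funpow_t_mem: "v \<in> C \<Longrightarrow> (t ^^ k) v \<in> C"
  by (induction k) (use permutes_in_image[OF t_permutes] in auto)

text \<open>This is the dihedral relation: as a composition, \<open>t p t = q p p q p = p\<close>,
  so \<open>p\<close> reverses the cycles of \<open>t\<close>.\<close>

private lemma funpow_p_funpow: "(t ^^ k) (p ((t ^^ k) u)) = p u"
proof (induction k)
  case (Suc k)
  have "(t ^^ Suc k) (p ((t ^^ Suc k) u)) = (t ^^ k) (t (p (t ((t ^^ k) u))))"
    by (simp add: funpow_swap1)
  also have "t (p (t ((t ^^ k) u))) = p ((t ^^ k) u)"
    using involution_on_involutive[OF p] involution_on_involutive[OF q] by (simp add: t_def)
  finally show ?case using Suc.IH by simp
qed simp

private lemma q_eq: "q w = t (p w)"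
  using involution_on_involutive[OF p] by (simp add: t_def)

text \<open>Applying the injective map \<open>t ^^ k\<close> to both sides turns one of them into
  \<open>p v = v\<close> and moves the other to position \<open>2 * k\<close>.\<close>

private lemma p_fixes_iff:
  assumes "p v = v"
  shows "p ((t ^^ k) v) = (t ^^ k) v \<longleftrightarrow> least_power t v dvd 2 * k"
proof -
  have "p ((t ^^ k) v) = (t ^^ k) v \<longleftrightarrow> (t ^^ k) (p ((t ^^ k) v)) = (t ^^ k) ((t ^^ k) v)"
    by (simp add: funpow_t_eq_iff)
  also have "\<dots> \<longleftrightarrow> (t ^^ (2 * k)) v = v"
    using assms by (simp add: funpow_p_funpow funpow_add mult_2) metis
  finally show ?thesis by (simp add: least_power_dvd[OF t_permutation])
qed

private lemma q_fixes_iff: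
  assumes "p v = v"
  shows "q ((t ^^ k) v) = (t ^^ k) v \<longleftrightarrow> t v = (t ^^ (2 * k)) v"
proof -
  have "q ((t ^^ k) v) = (t ^^ k) v \<longleftrightarrow>
        (t ^^ k) (t (p ((t ^^ k) v))) = (t ^^ k) ((t ^^ k) v)"
    by (simp add: funpow_t_eq_iff q_eq)
  also have "(t ^^ k) (t (p ((t ^^ k) v))) = t v"
    using assms by (simp flip: funpow_swap1 add: funpow_p_funpow)
  finally show ?thesis by (simp add: funpow_add mult_2)
qed

text \<open>On the cycle of \<open>t = q \<circ> p\<close> through a fixed point of \<open>p\<close>, both involutions act as
  reflections: \<open>p\<close> sends \<open>(t ^^ k) v\<close> to position \<open>- k\<close> and \<open>q\<close> sends it to position \<open>1 - k\<close>.
  A cycle of odd length therefore contains one fixed point of each, and a cycle of even length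
  contains two fixed points of \<open>p\<close> and none of \<open>q\<close>.\<close>

private lemma exists_even_cycle:
  assumes "card (fixed_points C q) < card (fixed_points C p)"
  obtains v where "v \<in> C" "p v = v" "even (least_power t v)"
proof -
  have "\<exists>v \<in> fixed_points C p. even (least_power t v)"
  proof (rule ccontr)
    assume "\<not> ?thesis"
    then have od: "odd (least_power t v)" if "v \<in> C" "p v = v" for v
      using that by (auto simp: fixed_points_def)
    \<comment> \<open>On a cycle of odd length \<open>l\<close>, position \<open>Suc l div 2\<close>
      solves \<open>2 * k = 1\<close> modulo \<open>l\<close>, which is the condition for
      \<open>q\<close> to fix it.\<close>
    define g where "g v = (t ^^ (Suc (least_power t v) div 2)) v" for v
    have "g ` fixed_points C p \<subseteq> fixed_points C q"
    proof
      fix y assume "y \<in> g ` fixed_points C p"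
      then obtain v where v: "v \<in> C" "p v = v" "y = g v" by (auto simp: fixed_points_def)
      have "2 * (Suc (least_power t v) div 2) = Suc (least_power t v)"
        using od[OF v(1,2)] by simp
      then have "(t ^^ (2 * (Suc (least_power t v) div 2))) v = t v"
        using least_power_of_permutation(1)[OF t_permutation, of v] by simp
      then have "q y = y"
        using q_fixes_iff[OF v(2)] by (simp add: v(3) g_def)
      then show "y \<in> fixed_points C q"
        using v by (simp add: fixed_points_def g_def funpow_t_mem)
    qed
    moreover have "inj_on g (fixed_points C p)"
    proof (rule inj_onI)
      fix v w assume vw: "v \<in> fixed_points C p" "w \<in> fixed_points C p" "g v = g w"
      define a b where "a = Suc (least_power t v) div 2" and "b = Suc (least_power t w) div 2"
      have ab: "(t ^^ a) v = (t ^^ b) w" using vw(3) by (simp add: g_def a_def b_def)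
      \<comment> \<open>A multiple of the period of \<open>w\<close> that is at least
        \<open>b\<close>, so \<open>t ^^ (n - b)\<close> leads from \<open>(t ^^ b) w\<close> back
        to \<open>w\<close>.\<close>
      define n where "n = b * least_power t w"
      have "b \<le> n" using least_power_of_permutation(2)[OF t_permutation, of w] by (simp add: n_def)
      have "(t ^^ n) w = w"
        unfolding n_def using least_power_dvd[OF t_permutation] by (metis dvd_triv_right)
      then have "w = (t ^^ (n - b)) ((t ^^ b) w)"
        using \<open>b \<le> n\<close> by (metis add.commute comp_apply funpow_add le_add_diff_inverse)
      then have w: "w = (t ^^ (n - b + a)) v"
        using ab by (simp add: funpow_add)
      \<comment> \<open>Now \<open>w\<close> is a fixed point of \<open>p\<close> on the cycle of
        \<open>v\<close>; the length being odd, its position must be \<open>0\<close>.\<close>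
      have "least_power t v dvd 2 * (n - b + a)"
        using p_fixes_iff[of v "n - b + a"] vw w by (simp add: fixed_points_def)
      moreover have "coprime (least_power t v) 2"
        using od[of v] vw by (simp add: fixed_points_def)
      ultimately have "least_power t v dvd n - b + a"
        using coprime_dvd_mult_right_iff by blast
      then show "v = w"
        using w by (simp add: least_power_dvd[OF t_permutation])
    qed
    ultimately have "card (fixed_points C p) \<le> card (fixed_points C q)"
      using fin by (intro card_inj_on_le[of g]) (auto simp: fixed_points_def)
    then show False using assms by simp
  qed
  then show thesis using that by (auto simp: fixed_points_def)
qed

text \<open>The even cycle of \<open>t\<close> just found is closed under both involutions. It is
  the vertex set of a Kempe path whose two ends are the fixed points of \<open>p\<close>.\<close>

lemma kempe_component:
  assumes "card (fixed_points C q) < card (fixed_points C p)"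
  obtains S where "S \<subseteq> C" "\<And>v. v \<in> S \<Longrightarrow> p v \<in> S" "\<And>v. v \<in> S \<Longrightarrow> q v \<in> S"
    "card (fixed_points S p) = 2" "fixed_points S q = {}"
proof -
  obtain v where v: "v \<in> C" "p v = v" "even (least_power t v)"
    using exists_even_cycle[OF assms] .
  define n where "n = least_power t v"
  have n: "n > 0" "even n" "\<And>k. (t ^^ k) v = v \<longleftrightarrow> n dvd k"
    using v least_power_of_permutation(2)[OF t_permutation] least_power_dvd[OF t_permutation]
    by (simp_all add: n_def)
  define l where "l = n div 2"
  have l: "n = 2 * l" "l > 0" using n by (auto simp: l_def)
  define S where "S = range (\<lambda>k. (t ^^ k) v)"
  have pS: "p w \<in> S" if w: "w \<in> S" for w
  proof -
    obtain k where k: "w = (t ^^ k) v" using w by (auto simp: S_def)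
    \<comment> \<open>The reflected position \<open>- k\<close> modulo \<open>n\<close> is written
      \<open>(n - 1) * k\<close> to remain a natural number.\<close>
    have "(t ^^ k) (p w) = (t ^^ k) ((t ^^ ((n - 1) * k)) v)"
    proof -
      have "(t ^^ k) ((t ^^ ((n - 1) * k)) v) = (t ^^ (k + (n - 1) * k)) v"
        by (simp add: funpow_add)
      also have "k + (n - 1) * k = n * k" using n(1) by (simp add: algebra_simps)
      also have "(t ^^ (n * k)) v = v" using n(3) by simp
      finally show ?thesis using v(2) by (simp add: k funpow_p_funpow)
    qed
    then have "p w = (t ^^ ((n - 1) * k)) v" by (simp add: funpow_t_eq_iff)
    then show ?thesis by (simp add: S_def)
  qed
  have tS: "t w \<in> S" if w: "w \<in> S" for w
  proof -
    obtain k where "w = (t ^^ k) v" using w by (auto simp: S_def)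
    then have "t w = (t ^^ Suc k) v" by simp
    then show ?thesis unfolding S_def by blast
  qed
  have "fixed_points S p = {v, (t ^^ l) v}"
  proof
    show "fixed_points S p \<subseteq> {v, (t ^^ l) v}"
    proof
      fix w assume "w \<in> fixed_points S p"
      then obtain k where k: "w = (t ^^ k) v" "p w = w" by (auto simp: fixed_points_def S_def)
      \<comment> \<open>The multiples of \<open>l = n div 2\<close> are only two positions modulo
        \<open>n\<close>: \<open>0\<close> for even \<open>j\<close> and \<open>l\<close> for odd
        \<open>j\<close>.\<close>
      then have "l dvd k" using p_fixes_iff[OF v(2), of k] l by (simp flip: n_def)
      then obtain j where j: "k = l * j" by auto
      show "w \<in> {v, (t ^^ l) v}"
      proof (cases "even j")
        case True
        then show ?thesis using n(3)[of k] l k j by auto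
      next
        case False
        then obtain i where "j = 2 * i + 1" using oddE by blast
        then have "k = l + n * i" using j l(1) by (simp add: algebra_simps)
        moreover have "(t ^^ (n * i)) v = v" using n(3) by simp
        ultimately show ?thesis using k by (simp add: funpow_add)
      qed
    qed
    have "v \<in> S" "(t ^^ l) v \<in> S" by (auto simp: S_def intro: range_eqI[of _ _ 0])
    moreover have "p ((t ^^ l) v) = (t ^^ l) v"
      using p_fixes_iff[OF v(2), of l] l(1) by (simp flip: n_def)
    ultimately show "{v, (t ^^ l) v} \<subseteq> fixed_points S p"
      using v(2) by (simp add: fixed_points_def)
  qed
  moreover have "(t ^^ l) v \<noteq> v" using n(3) l by (simp add: nat_dvd_not_less)
  ultimately have "card (fixed_points S p) = 2" by simp
  moreover have "q w \<noteq> w" if w: "w \<in> S" for w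
  proof
    assume "q w = w"
    obtain k where k: "w = (t ^^ k) v" using w by (auto simp: S_def)
    then have "t v = (t ^^ (2 * k)) v" using q_fixes_iff[OF v(2)] \<open>q w = w\<close> by simp
    \<comment> \<open>Going around twice more makes the exponent positive, so one \<open>t\<close>
      can be cancelled even if \<open>k = 0\<close>. The even \<open>n\<close> then divides an odd
      number.\<close>
    moreover have "(t ^^ (2 * (k + n))) v = (t ^^ (2 * k)) v"
      using n(3)[of "2 * n"] by (simp add: funpow_add distrib_left del: funpow.simps)
    moreover have "2 * (k + n) = Suc (2 * (k + n) - 1)" using n(1) by simp
    then have "(t ^^ (2 * (k + n))) v = t ((t ^^ (2 * (k + n) - 1)) v)"
      by (metis comp_apply funpow.simps(2))
    ultimately have "(t ^^ (2 * (k + n) - 1)) v = v"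
      using funpow_t_eq_iff[of 1] by simp
    then have "n dvd 2 * (k + n) - 1" using n(3) by blast
    then have "even (2 * (k + n) - 1)" using n(2) dvd_trans by blast
    then show False using n(1) by simp
  qed
  moreover have "S \<subseteq> C" using v(1) by (auto simp: S_def funpow_t_mem)
  moreover have "q w \<in> S" if "w \<in> S" for w using that by (simp add: q_eq pS tS)
  ultimately show thesis using that pS by (auto simp: fixed_points_def)
qed

end

subsection \<open>Changing the numbers of fixed points\<close>

lemma finite_fixed_points [simp]: "finite C \<Longrightarrow> finite (fixed_points C f)"
  by (simp add: fixed_points_def)

lemma sun_system_involution: "sun_system K C m \<Longrightarrow> i \<in> K \<Longrightarrow> involution_on C (m i)"
  by (simp add: sun_system_def)

lemma sun_system_eqD:
  "sun_system K C m \<Longrightarrow> v \<in> C \<Longrightarrow> i \<in> K \<Longrightarrow> j \<in> K \<Longrightarrow> m i v = m j v \<Longrightarrow> i = j"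
  unfolding sun_system_def by (meson inj_onD)

text \<open>Each vertex is fixed by exactly one \<open>m i\<close>, namely that of its pendant
  color.\<close>

lemma sum_card_fixed_points:
  assumes "finite C" "finite K" "sun_system K C m"
  shows "(\<Sum>i\<in>K. card (fixed_points C (m i))) = card C"
proof -
  have "C = (\<Union>i\<in>K. fixed_points C (m i))"
    using assms(3) by (auto simp: sun_system_def fixed_points_def)
  moreover have "card (\<Union>i\<in>K. fixed_points C (m i)) = (\<Sum>i\<in>K. card (fixed_points C (m i)))"
  proof (rule card_UN_disjoint)
    show "\<forall>i\<in>K. \<forall>j\<in>K. i \<noteq> j \<longrightarrow> fixed_points C (m i) \<inter> fixed_points C (m j) = {}"
      using sun_system_eqD[OF assms(3)] by (fastforce simp: fixed_points_def)
  qed (use assms in auto)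
  ultimately show ?thesis by simp
qed

text \<open>The Kempe swap: exchange \<open>m i\<close> and \<open>m j\<close> on \<open>S\<close>.
  Closure of \<open>S\<close> under both keeps them involutions, and at each vertex of
  \<open>S\<close> the same values occur with two labels exchanged.\<close>

lemma sun_system_move:
  assumes "finite C" and sys: "sun_system K C m" and ij: "i \<in> K" "j \<in> K"
    and less: "card (fixed_points C (m j)) < card (fixed_points C (m i))"
  obtains m' where "sun_system K C m'"
    "card (fixed_points C (m i)) = card (fixed_points C (m' i)) + 2"
    "card (fixed_points C (m' j)) = card (fixed_points C (m j)) + 2"
    "\<And>k. k \<noteq> i \<Longrightarrow> k \<noteq> j \<Longrightarrow> m' k = m k"
proof -
  note inv = sun_system_involution[OF sys]
  have "i \<noteq> j" using less by auto
  obtain S where S: "S \<subseteq> C" "\<And>v. v \<in> S \<Longrightarrow> m i v \<in> S" "\<And>v. v \<in> S \<Longrightarrow> m j v \<in> S"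
    "card (fixed_points S (m i)) = 2" "fixed_points S (m j) = {}"
    using kempe_component[OF assms(1) inv[OF ij(1)] inv[OF ij(2)] less] by metis
  define s where "s = transpose i j"
  have sK: "s k \<in> K \<longleftrightarrow> k \<in> K" for k using ij by (auto simp: s_def transpose_def)
  define m' where "m' k v = (if v \<in> S then m (s k) v else m k v)" for k v
  have m'k: "m' k = m k" if "k \<noteq> i" "k \<noteq> j" for k
    using that by (auto simp: m'_def s_def)
  have mS: "m k v \<in> S \<longleftrightarrow> v \<in> S" if "k = i \<or> k = j" for k v
    using that S(2,3) involution_on_involutive inv ij by metis
  have m'_inv: "involution_on C (m' k)" if "k \<in> K" for k
  proof (cases "k = i \<or> k = j")
    case True
    then have "s k = i \<or> s k = j" by (auto simp: s_def)
    then show ?thesis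
      using True mS inv[OF that] inv[of "s k"] S(1) that
      by (auto simp: involution_on_def m'_def sK)
  qed (use m'k inv that in auto)
  have "sun_system K C m'"
    unfolding sun_system_def
  proof (intro conjI ballI)
    fix v assume v: "v \<in> C"
    show "inj_on (\<lambda>k. m' k v) K"
    proof (rule inj_onI)
      fix k l assume kl: "k \<in> K" "l \<in> K" "m' k v = m' l v"
      show "k = l"
      proof (cases "v \<in> S")
        case True
        then have "s k = s l" using sun_system_eqD[OF sys v, of "s k" "s l"] kl by (simp add: m'_def sK)
        then show ?thesis unfolding s_def by (metis transpose_involutory)
      qed (use sun_system_eqD[OF sys v] kl in \<open>simp add: m'_def\<close>)
    qed
    obtain k where k: "k \<in> K" "m k v = v" using sys v by (auto simp: sun_system_def)
    show "\<exists>k\<in>K. m' k v = v"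
    proof (cases "v \<in> S")
      case True
      then have "m' (s k) v = v" using k by (simp add: m'_def s_def)
      then show ?thesis using k sK by blast
    qed (use k in \<open>auto simp: m'_def\<close>)
  qed (use m'_inv in auto)
  moreover have fin: "finite S" using S(1) assms(1) finite_subset by blast
  have split: "card (fixed_points C f) = card (fixed_points S f) + card (fixed_points (C - S) f)" for f
  proof -
    have "fixed_points C f = fixed_points S f \<union> fixed_points (C - S) f"
      using S(1) by (auto simp: fixed_points_def)
    moreover have "card (fixed_points S f \<union> fixed_points (C - S) f) =
        card (fixed_points S f) + card (fixed_points (C - S) f)"
      using fin assms(1) by (intro card_Un_disjoint) (auto simp: fixed_points_def)
    ultimately show ?thesis by simp
  qed
  have "fixed_points S (m' k) = fixed_points S (m (s k))"
       "fixed_points (C - S) (m' k) = fixed_points (C - S) (m k)" for k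
    by (auto simp: fixed_points_def m'_def)
  \<comment> \<open>On \<open>S\<close> the counts \<open>2\<close> and \<open>0\<close> trade
    places; off \<open>S\<close> nothing changes.\<close>
  then have "card (fixed_points C (m' i)) = card (fixed_points (C - S) (m i))"
       "card (fixed_points C (m' j)) = 2 + card (fixed_points (C - S) (m j))"
    using S(4,5) by (simp_all add: split[of "m' _"] s_def)
  then have "card (fixed_points C (m i)) = card (fixed_points C (m' i)) + 2"
    "card (fixed_points C (m' j)) = card (fixed_points C (m j)) + 2"
    using S(4,5) by (simp_all add: split[of "m i"] split[of "m j"])
  ultimately show thesis
    using that m'k by blast
qed

text \<open>Since color \<open>a\<close> ends up with the most pendant edges, it has more than any color that
  still lacks some, so it can always give two of its own away.\<close>

lemma sun_system_redistribute:
  assumes "finite C" "finite K" "a \<in> K" "sun_system K C m"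
    and "\<And>i. i \<in> K - {a} \<Longrightarrow> card (fixed_points C (m i)) \<le> x i"
    and "\<And>i. i \<in> K - {a} \<Longrightarrow> even (card (fixed_points C (m i))) \<longleftrightarrow> even (x i)"
    and xmax: "\<And>i. i \<in> K \<Longrightarrow> x i \<le> x a"
    and xsum: "sum x K = card C"
  shows "\<exists>m'. sun_system K C m' \<and> (\<forall>i\<in>K. card (fixed_points C (m' i)) = x i)"
  using assms(4-6)
proof (induction "\<Sum>i\<in>K - {a}. x i - card (fixed_points C (m i))" arbitrary: m rule: less_induct)
  \<comment> \<open>The measure is the total number of pendant edges that the colors other than
    \<open>a\<close> still lack; a move lowers it by two.\<close>
  case (less m)
  define y where "y i = card (fixed_points C (m i))" for i
  have ysum: "y a + (\<Sum>i\<in>K - {a}. y i) = x a + (\<Sum>i\<in>K - {a}. x i)"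
    using sum_card_fixed_points[OF assms(1,2) less.prems(1)] assms(2,3) xsum
    by (simp flip: y_def add: sum.remove)
  show ?case
  proof (cases "\<forall>i\<in>K - {a}. y i = x i")
    case True
    then have "y a = x a" using ysum by simp
    then have "\<forall>i\<in>K. card (fixed_points C (m i)) = x i" using True by (auto simp: y_def)
    then show ?thesis using less.prems by blast
  next
    case False
    then obtain j where j: "j \<in> K - {a}" "y j \<noteq> x j" by blast
    then have "y j < x j" using less.prems(2)[OF j(1)] by (simp add: y_def)
    \<comment> \<open>Both distributions have total \<open>card C\<close>, so a deficit outside
      \<open>a\<close> is a surplus at \<open>a\<close>.\<close>
    have "(\<Sum>i\<in>K - {a}. y i) < (\<Sum>i\<in>K - {a}. x i)"
      using assms(2) less.prems(2) j(1) \<open>y j < x j\<close>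
      by (intro sum_strict_mono_ex1) (auto simp: y_def)
    then have "x a < y a" using ysum by linarith
    then have "y j < y a" using \<open>y j < x j\<close> xmax[of j] j by simp
    then obtain m' where m': "sun_system K C m'"
      "card (fixed_points C (m' j)) = y j + 2" "\<And>k. k \<noteq> a \<Longrightarrow> k \<noteq> j \<Longrightarrow> m' k = m k"
      using sun_system_move[OF assms(1) less.prems(1) assms(3), of j] j(1) unfolding y_def by blast
    \<comment> \<open>Equal parity excludes \<open>x j = Suc (y j)\<close>, so the move does not
      overshoot.\<close>
    have le: "y j + 2 \<le> x j"
      using \<open>y j < x j\<close> less.prems(3)[OF j(1)] by (cases "x j = Suc (y j)") (auto simp: y_def)
    have eq: "card (fixed_points C (m' i)) = (if i = j then y j + 2 else y i)" if "i \<in> K - {a}" for i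
      using that m' by (auto simp: y_def)
    show ?thesis
    proof (rule less.hyps[OF _ m'(1)])
      show "(\<Sum>i\<in>K - {a}. x i - card (fixed_points C (m' i))) <
            (\<Sum>i\<in>K - {a}. x i - card (fixed_points C (m i)))"
        using assms(2) j(1) le
        by (intro sum_strict_mono_ex1 bexI[of _ j]) (auto simp: eq simp flip: y_def)
    next
      fix i assume i: "i \<in> K - {a}"
      show "card (fixed_points C (m' i)) \<le> x i"
        using eq[OF i] le less.prems(2)[OF i] by (simp add: y_def)
      show "even (card (fixed_points C (m' i))) \<longleftrightarrow> even (x i)"
        using eq[OF i] less.prems(3)[OF i] by (cases "i = j") (simp_all add: y_def)
    qed
  qed
qed

subsection \<open>Transport along a bijection\<close>

text \<open>Carries the systems built on integers over to the given vertex set.\<close>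

lemma sun_system_transport:
  assumes sys: "sun_system K A m" and \<phi>: "bij_betw \<phi> A C"
  obtains m' where "sun_system K C m'" "\<And>i v. v \<in> A \<Longrightarrow> m' i (\<phi> v) = \<phi> (m i v)"
proof -
  define \<psi> where "\<psi> = inv_into A \<phi>"
  define m' where "m' i w = (if w \<in> C then \<phi> (m i (\<psi> w)) else w)" for i w
  have \<psi>: "\<psi> (\<phi> v) = v" "\<phi> v \<in> C" if "v \<in> A" for v
    using \<phi> that by (auto simp: \<psi>_def bij_betw_def)
  have surj: "\<exists>v\<in>A. w = \<phi> v" if "w \<in> C" for w
    using \<phi> that by (auto simp: bij_betw_def)
  have inj: "\<phi> v = \<phi> w \<longleftrightarrow> v = w" if "v \<in> A" "w \<in> A" for v w
    using \<phi> that by (auto simp: bij_betw_def inj_on_def)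
  have m': "m' i (\<phi> v) = \<phi> (m i v)" if "v \<in> A" for i v
    using \<psi>[OF that] by (simp add: m'_def)
  have mem: "m i v \<in> A" if "i \<in> K" "v \<in> A" for i v
    using sun_system_involution[OF sys] that involution_on_mem by metis
  have "sun_system K C m'"
    unfolding sun_system_def
  proof (intro conjI ballI)
    fix i assume "i \<in> K"
    then have "m' i (m' i w) = w" for w
      using surj[of w] m' mem involution_on_involutive[OF sun_system_involution[OF sys]]
      by (cases "w \<in> C") (force, simp add: m'_def)
    then show "involution_on C (m' i)" by (auto simp: involution_on_def m'_def)
  next
    fix w assume "w \<in> C"
    then obtain v where v: "v \<in> A" "w = \<phi> v" using surj by blast
    show "inj_on (\<lambda>i. m' i w) K"
      using v mem sun_system_eqD[OF sys v(1)] by (auto simp: inj_on_def m' inj)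
    obtain i where "i \<in> K" "m i v = v" using v(1) sys by (auto simp: sun_system_def)
    then show "\<exists>i\<in>K. m' i w = w" using m'[OF v(1)] v(2) by (intro bexI[of _ i]) simp_all
  qed
  then show thesis using that m' by blast
qed

text \<open>Bijections between corresponding fibres are glued. This matches vertices by pendant
  color, so that only the number of pendant edges of each color matters.\<close>

lemma bij_betw_with_equal_fibres:
  assumes "finite A" "finite C" "h \<in> A \<rightarrow> K" "g \<in> C \<rightarrow> K"
    and "\<And>i. i \<in> K \<Longrightarrow> card {v \<in> A. h v = i} = card {w \<in> C. g w = i}"
  obtains \<phi> where "bij_betw \<phi> A C" "\<And>v. v \<in> A \<Longrightarrow> g (\<phi> v) = h v"
proof -
  have "\<exists>f. bij_betw f {v \<in> A. h v = i} {w \<in> C. g w = i}" if "i \<in> K" for i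
    using assms that by (intro finite_same_card_bij) auto
  then obtain F where F: "\<And>i. i \<in> K \<Longrightarrow> bij_betw (F i) {v \<in> A. h v = i} {w \<in> C. g w = i}"
    by metis
  define \<phi> where "\<phi> v = F (h v) v" for v
  have \<phi>: "\<phi> v \<in> C \<and> g (\<phi> v) = h v" if "v \<in> A" for v
    using bij_betwE[OF F[of "h v"]] that assms(3) by (auto simp: \<phi>_def)
  have "inj_on \<phi> A"
  proof (rule inj_onI)
    fix v w assume vw: "v \<in> A" "w \<in> A" "\<phi> v = \<phi> w"
    then have "h v = h w" using \<phi> by metis
    moreover have "h v \<in> K" using vw assms(3) by blast
    ultimately show "v = w"
      using vw bij_betw_imp_inj_on[OF F[of "h v"]] by (auto simp: \<phi>_def dest: inj_onD)
  qed
  moreover have "C \<subseteq> \<phi> ` A"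
  proof
    fix w assume w: "w \<in> C"
    then have "w \<in> F (g w) ` {v \<in> A. h v = g w}"
      using bij_betw_imp_surj_on[OF F[of "g w"]] assms(4) by auto
    then show "w \<in> \<phi> ` A" by (force simp: \<phi>_def)
  qed
  ultimately have "bij_betw \<phi> A C" using \<phi> by (auto simp: bij_betw_def)
  then show thesis using that \<phi> by blast
qed

subsection \<open>Initial colorings from reflections of a cyclic group\<close>

lemma dvd_double_diffD:
  fixes n u w :: int
  assumes "odd n" "n dvd 2 * (u - w)" "u \<in> {0..<n}" "w \<in> {0..<n}"
  shows "u = w"
proof -
  have "n dvd u - w"
    using assms(1,2) coprime_dvd_mult_right_iff[of n 2 "u - w"] by simp
  then show ?thesis using assms(3,4)
    by (metis atLeastLessThan_iff mod_eq_dvd_iff mod_pos_pos_trivial)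
qed

text \<open>Since \<open>2\<close> is invertible modulo an odd \<open>n\<close>, reflections about
  different centers disagree everywhere. This keeps the colors at a vertex apart.\<close>

lemma reflection_eq_iff:
  fixes n u w v :: int
  assumes "odd n" "u \<in> {0..<n}" "w \<in> {0..<n}"
  shows "(2 * u - v) mod n = (2 * w - v) mod n \<longleftrightarrow> u = w"
proof
  assume "(2 * u - v) mod n = (2 * w - v) mod n"
  then have "n dvd 2 * (u - w)" by (simp add: mod_eq_dvd_iff algebra_simps)
  then show "u = w" using dvd_double_diffD assms by blast
qed simp

lemma reflection_fixes_iff:
  fixes n u v :: int
  assumes "odd n" "u \<in> {0..<n}" "v \<in> {0..<n}"
  shows "(2 * u - v) mod n = v \<longleftrightarrow> u = v"
proof -
  have "(2 * v - v) mod n = v" using assms(3) by simp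
  then show ?thesis using reflection_eq_iff[OF assms, of v] by simp
qed

lemma reflection_involutive:
  fixes n u v :: int
  assumes "v \<in> {0..<n}"
  shows "(2 * u - (2 * u - v) mod n) mod n = v"
  using assms by (simp add: mod_simps)

text \<open>The round-robin tournament: \<open>n = r - 1\<close> is odd and serves as the point at
  infinity. Color \<open>i\<close> joins it to the center \<open>u i\<close> and pairs the other
  points by reflection about \<open>u i\<close>; color \<open>a\<close> is the identity.\<close>

lemma exists_sun_system_even:
  assumes "finite K" "a \<in> K" "even r" "card K \<le> r"
  shows "\<exists>(A :: int set) m. finite A \<and> card A = r \<and> sun_system K A m \<and>
           (\<forall>i\<in>K - {a}. card (fixed_points A (m i)) = 0)"
proof -
  define n where "n = int r - 1"
  have "card K > 0" using assms(1,2) card_gt_0_iff by blast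
  then have n: "n \<ge> 0" "odd n" using assms(3,4) by (simp_all add: n_def)
  have "card (K - {a}) \<le> card {0..<n}"
    using assms \<open>card K > 0\<close> by (simp add: n_def nat_diff_distrib)
  then obtain u where u: "u ` (K - {a}) \<subseteq> {0..<n}" "inj_on u (K - {a})"
    using card_le_inj[of "K - {a}" "{0..<n}"] assms(1) by auto
  have un: "u i \<in> {0..<n}" if "i \<in> K" "i \<noteq> a" for i using u(1) that by blast
  have u_eq: "u i = u j \<longleftrightarrow> i = j" if "i \<in> K" "i \<noteq> a" "j \<in> K" "j \<noteq> a" for i j
    using u(2) that by (auto simp: inj_on_def)
  define m where "m i v = (if i = a \<or> v \<notin> {0..n} then v else if v = n then u i
     else if v = u i then n else (2 * u i - v) mod n)" for i v
  have mod_range: "(2 * x - v) mod n \<in> {0..<n}" if "v \<in> {0..<n}" for x v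
    using that by simp
  have mod_ne: "(2 * x - v) mod n \<noteq> n" if "v \<in> {0..<n}" for x v
    using mod_range[OF that, of x] by (metis atLeastLessThan_iff less_irrefl)
  have m_n: "m i n = u i" if "i \<in> K" "i \<noteq> a" for i
    using that n by (simp add: m_def)
  have m_v: "m i v = (if v = u i then n else (2 * u i - v) mod n)"
    if "i \<in> K" "i \<noteq> a" "v \<in> {0..<n}" for i v
    using that by (simp add: m_def)
  have no_fix: "m i v \<noteq> v" if "i \<in> K" "i \<noteq> a" "v \<in> {0..n}" for i v
  proof (cases "v = n")
    case True
    then show ?thesis using un[OF that(1,2)] m_n[OF that(1,2)] by simp
  next
    case False
    then have v: "v \<in> {0..<n}" using that(3) by simp
    then show ?thesis
      using m_v[OF that(1,2) v] reflection_fixes_iff[OF n(2) un[OF that(1,2)] v] by auto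
  qed
  have "involution_on {0..n} (m i)" if "i \<in> K" for i
    unfolding involution_on_def
  proof (intro conjI allI impI)
    fix v
    show "m i (m i v) = v"
    proof (cases "i = a \<or> v \<notin> {0..n}")
      case True
      then show ?thesis by (auto simp: m_def)
    next
      case False
      then have i: "i \<in> K" "i \<noteq> a" using that by auto
      note ui = un[OF i]
      consider "v = n" | "v = u i" | "v \<in> {0..<n}" "v \<noteq> u i" using False by force
      then show ?thesis
      proof cases
        case 3
        define w where "w = (2 * u i - v) mod n"
        have w: "w \<in> {0..<n}" using mod_range[OF 3(1)] by (simp add: w_def)
        have v: "(2 * u i - w) mod n = v"
          unfolding w_def by (rule reflection_involutive[OF 3(1)])
        \<comment> \<open>Were \<open>w\<close> the center, reflecting back would give
          \<open>v = u i\<close>.\<close>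
        moreover have "w \<noteq> u i" using v ui 3(2) by auto
        ultimately have "m i w = v" using m_v[OF i w] by simp
        then show ?thesis using m_v[OF i 3(1)] 3(2) by (simp add: w_def)
      qed (use m_n[OF i] m_v[OF i ui] in simp_all)
    qed
  qed (simp add: m_def)
  moreover have "inj_on (\<lambda>i. m i v) K" if v: "v \<in> {0..n}" for v
  proof (rule inj_onI)
    fix i j assume ij: "i \<in> K" "j \<in> K" "m i v = m j v"
    \<comment> \<open>The mixed case is impossible: \<open>m a\<close> fixes everything, the other
      involutions fix nothing.\<close>
    have "m a v = v" by (simp add: m_def)
    then consider "i = a" "j = a" | "i \<noteq> a" "j \<noteq> a" using no_fix ij v by metis
    then show "i = j"
    proof cases
      case 2
      note i = ij(1) 2(1) and j = ij(2) 2(2)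
      show ?thesis
      proof (cases "v = n")
        case True
        then show ?thesis using ij(3) m_n[OF i] m_n[OF j] u_eq[OF i j] by simp
      next
        case False
        then have v': "v \<in> {0..<n}" using v by simp
        show ?thesis
          using ij(3) m_v[OF i v'] m_v[OF j v'] u_eq[OF i j] mod_ne[OF v']
            reflection_eq_iff[OF n(2) un[OF i] un[OF j], of v]
          by (metis (full_types))
      qed
    qed simp
  qed
  moreover have "m a v = v" for v by (simp add: m_def)
  ultimately have "sun_system K {0..n} m" using assms(2) unfolding sun_system_def by blast
  moreover have "fixed_points {0..n} (m i) = {}" if "i \<in> K - {a}" for i
    using no_fix that by (auto simp: fixed_points_def)
  moreover have "card {0..n} = r" by (simp add: n_def)
  ultimately show ?thesis by (metis card.empty finite_atLeastAtMost_int)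
qed

text \<open>Color \<open>i \<noteq> a\<close> is the reflection about \<open>u i\<close>, where the centers form a symmetric set
  avoiding \<open>0\<close>; color \<open>a\<close> joins each center to its negative, which is consistent because the
  midpoint \<open>0\<close> of that edge is not a center.\<close>

lemma exists_sun_system_odd:
  assumes "finite K" "a \<in> K" "odd r" "odd (card K)" "card K \<le> r"
  shows "\<exists>(A :: int set) m. finite A \<and> card A = r \<and> sun_system K A m \<and>
           (\<forall>i\<in>K - {a}. card (fixed_points A (m i)) = 1)"
proof -
  define n where "n = int r"
  have n: "odd n" "n > 0" using assms(3) by (auto simp: n_def odd_pos)
  obtain k where k: "card K = 2 * k + 1" using assms(4) oddE by blast
  \<comment> \<open>These are the residues of \<open>1, ..., k\<close> and their negatives, distinct
    because \<open>2 * k < n\<close>. There is one for each of the \<open>2 * k\<close> colors other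
    than \<open>a\<close>.\<close>
  define U where "U = {1..int k} \<union> {n - int k..<n}"
  have kn: "2 * int k < n" using k assms(5) by (simp add: n_def)
  have "card U = card {1..int k} + card {n - int k..<n}"
    unfolding U_def using kn by (intro card_Un_disjoint) auto
  then have "card (K - {a}) = card U" using k assms(1,2) by simp
  moreover have "finite U" by (simp add: U_def)
  ultimately obtain u where u: "bij_betw u (K - {a}) U"
    using finite_same_card_bij[of "K - {a}" U] assms(1) by blast
  have U: "v \<in> {0..<n}" "v > 0" "n - v \<in> U" if "v \<in> U" for v
    using that kn by (auto simp: U_def)
  have uU: "u i \<in> U" if "i \<in> K" "i \<noteq> a" for i using bij_betwE[OF u] that by blast
  have un: "u i \<in> {0..<n}" if "i \<in> K" "i \<noteq> a" for i using U uU that by blast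
  have u_eq: "u i = u j \<longleftrightarrow> i = j" if "i \<in> K" "i \<noteq> a" "j \<in> K" "j \<noteq> a" for i j
    using bij_betw_imp_inj_on[OF u] that by (auto simp: inj_on_def)
  define m where "m i v = (if v \<notin> {0..<n} then v else
      if i = a then if v \<in> U then n - v else v else (2 * u i - v) mod n)" for i v
  have m_v: "m i v = (2 * u i - v) mod n" if "i \<noteq> a" "v \<in> {0..<n}" for i v
    using that by (simp add: m_def)
  have m_a: "m a v = (if v \<in> U then n - v else v)" if "v \<in> {0..<n}" for v
    using that by (simp add: m_def)
  have ne_a: "m i v \<noteq> m a v" if "i \<in> K" "i \<noteq> a" and v: "v \<in> {0..<n}" for i v
  proof (cases "v \<in> U")
    case True
    show ?thesis
    proof
      assume "m i v = m a v"
      then have "(2 * u i - v) mod n = n - v" using True that by (simp add: m_v m_a)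
      moreover have "(n - v) mod n = n - v"
        using U[OF True] by (intro mod_pos_pos_trivial) auto
      \<comment> \<open>Negation is the reflection about \<open>0\<close>, so agreement would make
        \<open>0\<close> a center.\<close>
      ultimately have "(2 * u i - v) mod n = (2 * 0 - v) mod n"
        by simp
      then have "u i = 0"
        using reflection_eq_iff[OF n(1) un[OF that(1,2)], of 0 v] n(2) by simp
      then show False using U(2)[OF uU[OF that(1,2)]] by simp
    qed
  next
    case False
    then show ?thesis
      using reflection_fixes_iff[OF n(1) un[OF that(1,2)] v] uU[OF that(1,2)] that
      by (auto simp: m_v m_a)
  qed
  have "involution_on {0..<n} (m i)" if "i \<in> K" for i
    unfolding involution_on_def
  proof (intro conjI allI impI)
    fix v
    consider "v \<notin> {0..<n}" | "v \<in> {0..<n}" "i = a" | "v \<in> {0..<n}" "i \<noteq> a" by blast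
    then show "m i (m i v) = v"
    proof cases
      case 2
      then show ?thesis using U[of v] U[of "n - v"] by (cases "v \<in> U") (simp_all add: m_a)
    next
      case 3
      have "(2 * u i - v) mod n \<in> {0..<n}" using n(2) by simp
      then show ?thesis using 3 reflection_involutive[OF 3(1)] m_v by simp
    qed (simp add: m_def)
  qed (simp add: m_def)
  moreover have "inj_on (\<lambda>i. m i v) K" if v: "v \<in> {0..<n}" for v
  proof (rule inj_onI)
    fix i j assume ij: "i \<in> K" "j \<in> K" "m i v = m j v"
    consider "i = a" "j = a" | "i \<noteq> a" "j \<noteq> a" using ne_a ij v by metis
    then show "i = j"
    proof cases
      case 2
      then show ?thesis
        using ij v reflection_eq_iff[OF n(1) un un, of i j v] u_eq by (simp add: m_v)
    qed simp
  qed
  moreover have fixed: "m i v = v \<longleftrightarrow> v = u i" if "i \<in> K" "i \<noteq> a" "v \<in> {0..<n}" for i v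
    using reflection_fixes_iff[OF n(1) un[OF that(1,2)] that(3)] that m_v by auto
  moreover have "\<exists>i\<in>K. m i v = v" if v: "v \<in> {0..<n}" for v
  proof (cases "v \<in> U")
    case True
    then obtain i where "i \<in> K - {a}" "v = u i" using bij_betw_imp_surj_on[OF u] by blast
    then show ?thesis using fixed v by blast
  qed (use m_a[OF v] assms(2) in auto)
  ultimately have "sun_system K {0..<n} m" unfolding sun_system_def by blast
  moreover have "fixed_points {0..<n} (m i) = {u i}" if "i \<in> K - {a}" for i
    using fixed[of i] un[of i] that by (auto simp: fixed_points_def)
  then have "\<forall>i\<in>K - {a}. card (fixed_points {0..<n} (m i)) = 1" by simp
  moreover have "card {0..<n} = r" by (simp add: n_def)
  ultimately show ?thesis by (metis finite_atLeastLessThan_int)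
qed

text \<open>Take for \<open>a\<close> a most frequent color, redistribute an initial system on
  integers to the required counts, and transport it along a bijection respecting pendant
  colors.\<close>

lemma exists_sun_system:
  assumes "finite C" "finite K" "K \<noteq> {}" "card K \<le> card C" "g \<in> C \<rightarrow> K"
    and par: "\<And>i. i \<in> K \<Longrightarrow> even (card {v \<in> C. g v = i}) \<longleftrightarrow> even (card C)"
    and odd: "odd (card C) \<Longrightarrow> odd (card K)"
  obtains m where "sun_system K C m" "\<And>v. v \<in> C \<Longrightarrow> m (g v) v = v"
proof -
  define x where "x i = card {v \<in> C. g v = i}" for i
  have xsum: "sum x K = card C"
  proof -
    have "C = (\<Union>i\<in>K. {v \<in> C. g v = i})" using assms(5) by auto
    moreover have "card (\<Union>i\<in>K. {v \<in> C. g v = i}) = sum x K"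
      unfolding x_def using assms(1,2) by (intro card_UN_disjoint) auto
    ultimately show ?thesis by simp
  qed
  obtain a where a: "a \<in> K" "\<And>i. i \<in> K \<Longrightarrow> x i \<le> x a"
  proof -
    have "Max (x ` K) \<in> x ` K" using assms(2,3) by simp
    then obtain a where "a \<in> K" "x a = Max (x ` K)" by auto
    then show thesis using that assms(2) by (metis Max_ge finite_imageI imageI)
  qed
  have "\<exists>(A :: int set) m. finite A \<and> card A = card C \<and> sun_system K A m \<and>
      (\<forall>i\<in>K - {a}. card (fixed_points A (m i)) = (if even (card C) then 0 else 1))"
    using exists_sun_system_even[OF assms(2) a(1) _ assms(4)]
      exists_sun_system_odd[OF assms(2) a(1) _ odd assms(4)] by simp
  then obtain A :: "int set" and m where A: "finite A" "card A = card C" "sun_system K A m"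
    and fp: "\<And>i. i \<in> K - {a} \<Longrightarrow> card (fixed_points A (m i)) = (if even (card C) then 0 else 1)"
    by blast
  have "\<exists>m. sun_system K A m \<and> (\<forall>i\<in>K. card (fixed_points A (m i)) = x i)"
  proof (rule sun_system_redistribute[where x = x, OF A(1) assms(2) a(1) A(3)])
    fix i assume i: "i \<in> K - {a}"
    then have *: "even (x i) \<longleftrightarrow> even (card C)" using par by (simp add: x_def)
    \<comment> \<open>For odd \<open>card C\<close> the number \<open>x i\<close> is odd, hence at
      least the initial \<open>1\<close>.\<close>
    show "card (fixed_points A (m i)) \<le> x i"
      using fp[OF i] * by (cases "x i = 0") auto
    show "even (card (fixed_points A (m i))) \<longleftrightarrow> even (x i)" using fp[OF i] * by simp
  qed (use A xsum a(2) in simp_all)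
  then obtain m1 where m1: "sun_system K A m1" "\<And>i. i \<in> K \<Longrightarrow> card (fixed_points A (m1 i)) = x i"
    by blast
  \<comment> \<open>\<open>h\<close> reads off the pendant colors of the system on \<open>A\<close>;
    its fibres are the fixed point sets.\<close>
  have "\<forall>v\<in>A. \<exists>i\<in>K. m1 i v = v" using m1(1) by (simp add: sun_system_def)
  then obtain h where h: "\<And>v. v \<in> A \<Longrightarrow> h v \<in> K" "\<And>v. v \<in> A \<Longrightarrow> m1 (h v) v = v" by metis
  have "{v \<in> A. h v = i} = fixed_points A (m1 i)" if "i \<in> K" for i
    using h sun_system_eqD[OF m1(1)] that by (fastforce simp: fixed_points_def)
  then have fib: "card {v \<in> A. h v = i} = card {w \<in> C. g w = i}" if "i \<in> K" for i
    using m1(2) that by (simp add: x_def)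
  have "h \<in> A \<rightarrow> K" using h(1) by blast
  then obtain \<phi> where \<phi>: "bij_betw \<phi> A C" "\<And>v. v \<in> A \<Longrightarrow> g (\<phi> v) = h v"
    using bij_betw_with_equal_fibres[OF A(1) assms(1) _ assms(5) fib] by blast
  obtain m2 where m2: "sun_system K C m2" "\<And>i v. v \<in> A \<Longrightarrow> m2 i (\<phi> v) = \<phi> (m1 i v)"
    using sun_system_transport[OF m1(1) \<phi>(1)] by blast
  have "m2 (g w) w = w" if w: "w \<in> C" for w
  proof -
    obtain v where v: "v \<in> A" "w = \<phi> v" using bij_betw_imp_surj_on[OF \<phi>(1)] w by blast
    then show ?thesis by (simp add: m2(2) \<phi>(2) h(2))
  qed
  then show thesis using that m2(1) by blast
qed

subsection \<open>Edge colorings of suns\<close>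

lemma verts_sun [simp]: "verts (sun G) = Inl ` verts G \<union> Inr ` verts G"
  by (simp add: sun_def)

lemma edges_sun [simp]: "edges (sun G) = (`) Inl ` edges G \<union> pendant_edges (verts G)"
  by (simp add: sun_def)

lemma pendant_edge_eq_iff [simp]: "pendant_edge v = pendant_edge w \<longleftrightarrow> v = w"
  by (auto simp: pendant_edge_def doubleton_eq_iff)

lemma Inl_image_not_pendant [simp]:
  "Inl ` e \<noteq> pendant_edge v" "pendant_edge v \<noteq> Inl ` e"
  by (auto simp: pendant_edge_def)

lemma Inl_in_pendant_edge [simp]: "Inl v \<in> pendant_edge w \<longleftrightarrow> v = w"
  and Inr_in_pendant_edge [simp]: "Inr v \<in> pendant_edge w \<longleftrightarrow> v = w"
  by (auto simp: pendant_edge_def)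

lemma finite_edges: "simple_graph G \<Longrightarrow> finite (edges G)"
  unfolding simple_graph_def by (meson PowI finite_Pow_iff finite_subset subsetI)

section \<open>Valencies and chromatic index of the sun\<close>

lemma valency_sun_Inl:
  assumes "simple_graph G" "v \<in> verts G"
  shows "valency (sun G) (Inl v) = Suc (valency G v)"
proof -
  have "{e \<in> edges (sun G). Inl v \<in> e} =
      insert (pendant_edge v) ((`) Inl ` {e \<in> edges G. v \<in> e})"
    using assms(2) by (auto simp: pendant_edges_def)
  moreover have "inj_on ((`) Inl) A" for A :: "'a set set"
    by (auto simp: inj_on_def inj_image_eq_iff)
  then have "card ((`) Inl ` {e \<in> edges G. v \<in> e}) = valency G v"
    unfolding valency_def by (intro card_image)
  moreover have "pendant_edge v \<notin> (`) Inl ` {e \<in> edges G. v \<in> e}" by auto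
  ultimately show ?thesis
    using finite_edges[OF assms(1)] by (simp add: valency_def[of "sun G"])
qed

lemma valency_sun_Inr:
  assumes "v \<in> verts G"
  shows "valency (sun G) (Inr v) = 1"
proof -
  have "{e \<in> edges (sun G). Inr v \<in> e} = {pendant_edge v}"
    using assms by (auto simp: pendant_edges_def)
  then show ?thesis by (simp add: valency_def)
qed

lemma max_valency_sun:
  assumes "simple_graph G" "verts G \<noteq> {}" "regular (d - 1) G" "d \<ge> 1"
  shows "max_valency (sun G) = d"
proof -
  have "valency (sun G) (Inl v) = d" if "v \<in> verts G" for v
    using valency_sun_Inl[OF assms(1) that] assms(3,4) that by (simp add: regular_def)
  then have "valency (sun G) ` verts (sun G) = {d, 1}"
    using assms(2) by (auto simp: image_Un image_image valency_sun_Inr)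
  then show ?thesis using assms(4) by (simp add: max_valency_def)
qed

lemma proper_edge_coloring_inj_on:
  assumes "proper_edge_coloring G K f"
  shows "inj_on f {e \<in> edges G. v \<in> e}"
  using assms unfolding proper_edge_coloring_def inj_on_def by blast

lemma valency_le_colors:
  assumes "proper_edge_coloring G K f" "finite K"
  shows "valency G v \<le> card K"
  unfolding valency_def
  using assms proper_edge_coloring_inj_on[OF assms(1), of v]
  by (intro card_inj_on_le[of f]) (auto simp: proper_edge_coloring_def)

text \<open>A vertex of \<open>G\<close> has valency \<open>d\<close> in the sun, so at least
  \<open>d\<close> colors are needed and an extension shows that \<open>d\<close> suffice.
  Conversely, class I makes the palette \<open>{1..d}\<close>.\<close>

lemma extends_iff_class_one:
  assumes G: "simple_graph G" "verts G \<noteq> {}" "regular (d - 1) G" "d \<ge> 1"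
  shows "pendant_coloring_extends G {1..d} c \<longleftrightarrow> sun_class_one_with G c"
proof
  assume ext: "pendant_coloring_extends G {1..d} c"
  then obtain f where f: "proper_edge_coloring (sun G) {1..d} f"
    by (auto simp: pendant_coloring_extends_def)
  have "chromatic_index (sun G) = d"
    unfolding chromatic_index_def
  proof (rule Least_equality)
    fix k assume "\<exists>f. proper_edge_coloring (sun G) {1..k} f"
    then obtain f where f: "proper_edge_coloring (sun G) {1..k} f" ..
    obtain v where v: "v \<in> verts G" using G(2) by blast
    have "valency (sun G) (Inl v) = d"
      using valency_sun_Inl[OF G(1) v] G(3,4) v by (simp add: regular_def)
    then show "d \<le> k" using valency_le_colors[OF f, of "Inl v"] by simp
  qed (use f in blast)
  then show "sun_class_one_with G c"
    using ext max_valency_sun[OF G] by (simp add: sun_class_one_with_def class_one_def)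
next
  assume "sun_class_one_with G c"
  then show "pendant_coloring_extends G {1..d} c"
    using max_valency_sun[OF G] by (metis sun_class_one_with_def class_one_def)
qed

text \<open>All \<open>d\<close> colors occur at every vertex of \<open>G\<close>, so the edges of \<open>G\<close> of color \<open>i\<close>
  match up the vertices whose pendant edge does not have color \<open>i\<close>.\<close>

lemma even_card_other_pendant_color:
  assumes G: "simple_graph G" "regular (d - 1) G" "d \<ge> 1"
    and ext: "pendant_coloring_extends G {1..d} c" and i: "i \<in> {1..d}"
  shows "even (card {v \<in> verts G. c (pendant_edge v) \<noteq> i})"
proof -
  obtain f where f: "proper_edge_coloring (sun G) {1..d} f"
    and fc: "\<And>v. v \<in> verts G \<Longrightarrow> f (pendant_edge v) = c (pendant_edge v)"
    using ext by (auto simp: pendant_coloring_extends_def pendant_edges_def)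
  have diff: "f e \<noteq> f e'" if "e \<in> edges (sun G)" "e' \<in> edges (sun G)" "e \<noteq> e'" "e \<inter> e' \<noteq> {}" for e e'
    using f that unfolding proper_edge_coloring_def by blast
  define M where "M = {e \<in> edges G. f (Inl ` e) = i}"
  have finM: "finite M" using finite_edges[OF G(1)] by (simp add: M_def)
  have M2: "e \<subseteq> verts G" "card e = 2" if "e \<in> M" for e
    using G(1) that by (auto simp: M_def simple_graph_def)
  have "\<Union>M = {v \<in> verts G. c (pendant_edge v) \<noteq> i}"
  proof (intro set_eqI iffI)
    fix v assume "v \<in> \<Union>M"
    then obtain e where e: "e \<in> M" "v \<in> e" by blast
    then have v: "v \<in> verts G" using M2(1) by blast
    have "f (pendant_edge v) \<noteq> f (Inl ` e)"
      using e v by (intro diff) (auto simp: M_def pendant_edges_def pendant_edge_def)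
    then show "v \<in> {v \<in> verts G. c (pendant_edge v) \<noteq> i}"
      using e v fc by (auto simp: M_def)
  next
    fix v assume "v \<in> {v \<in> verts G. c (pendant_edge v) \<noteq> i}"
    then have v: "v \<in> verts G" "c (pendant_edge v) \<noteq> i" by auto
    define E where "E = {e \<in> edges (sun G). Inl v \<in> e}"
    have "f ` E \<subseteq> {1..d}" using f by (auto simp: E_def proper_edge_coloring_def)
    moreover have "card E = d"
      using valency_sun_Inl[OF G(1) v(1)] G(2,3) v(1)
      unfolding E_def regular_def valency_def[of "sun G"] by simp
    then have "card (f ` E) = card {1..d}"
      using card_image[OF proper_edge_coloring_inj_on[OF f], of "Inl v"] by (simp add: E_def)
    \<comment> \<open>The \<open>d\<close> edges at \<open>Inl v\<close> have distinct colors among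
      \<open>d\<close>, so none is missing.\<close>
    ultimately have "f ` E = {1..d}" by (intro card_subset_eq) auto
    then have "i \<in> f ` E" using i by simp
    then obtain e where e: "e \<in> E" "f e = i" by auto
    then have "e \<noteq> pendant_edge v" using v fc by auto
    then obtain e' where "e' \<in> edges G" "e = Inl ` e'" "v \<in> e'"
      using e by (auto simp: E_def pendant_edges_def)
    then show "v \<in> \<Union>M" using e by (auto simp: M_def)
  qed
  moreover have "card (\<Union>M) = sum card M"
  proof (rule card_Union_disjoint)
    show "pairwise disjnt M"
    proof (rule pairwiseI)
      fix e e' assume e: "e \<in> M" "e' \<in> M" "e \<noteq> e'"
      show "disjnt e e'"
      proof (rule ccontr)
        assume "\<not> disjnt e e'"
        then have "f (Inl ` e) \<noteq> f (Inl ` e')"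
          using e by (intro diff) (auto simp: M_def disjnt_def inj_image_eq_iff)
        then show False using e by (simp add: M_def)
      qed
    qed
    show "finite e" if "e \<in> M" for e using M2[OF that] by (simp add: card_ge_0_finite)
  qed
  ultimately have "card {v \<in> verts G. c (pendant_edge v) \<noteq> i} = sum card M" by simp
  also have "\<dots> = (\<Sum>e\<in>M. 2)" using M2(2) by simp
  finally show ?thesis by simp
qed

text \<open>Decodes a system: the pairs \<open>{v, m i v}\<close> of distinct vertices are the
  edges. At \<open>v\<close> only the pendant color gives no edge and the other colors give distinct
  neighbors, whence valency \<open>d - 1\<close>.\<close>

lemma sun_system_graph:
  assumes "finite C" "d \<ge> 1" and sys: "sun_system {1..d} C m"
    and c: "c \<in> pendant_edges C \<rightarrow> {1..d}"
    and mc: "\<And>v. v \<in> C \<Longrightarrow> m (c (pendant_edge v)) v = v"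
  shows "\<exists>G. simple_graph G \<and> verts G = C \<and> regular (d - 1) G \<and>
           pendant_coloring_extends G {1..d} c"
proof -
  note inv = sun_system_involution[OF sys]
  note m_eqD = sun_system_eqD[OF sys]
  define E where "E = {{v, m i v} | v i. v \<in> C \<and> i \<in> {1..d} \<and> m i v \<noteq> v}"
  define G where "G = UGraph C E"
  have mC: "m i v \<in> C" if "i \<in> {1..d}" "v \<in> C" for i v
    using involution_on_mem[OF inv[OF that(1)]] that by blast
  have mm: "m i (m i v) = v" if "i \<in> {1..d}" for i v
    using involution_on_involutive[OF inv[OF that]] .
  have cK: "c (pendant_edge v) \<in> {1..d}" if "v \<in> C" for v
    using c that by (auto simp: pendant_edges_def)
  have simple: "simple_graph G"
    using assms(1) mC by (auto simp: simple_graph_def G_def E_def card_insert_if)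
  have "valency G v = d - 1" if v: "v \<in> C" for v
  proof -
    let ?I = "{1..d} - {c (pendant_edge v)}"
    have nf: "m i v \<noteq> v \<longleftrightarrow> i \<noteq> c (pendant_edge v)" if "i \<in> {1..d}" for i
      using m_eqD[OF v that cK[OF v]] mc[OF v] by auto
    have "{e \<in> E. v \<in> e} = (\<lambda>i. {v, m i v}) ` ?I"
    proof (intro set_eqI iffI)
      fix e assume "e \<in> {e \<in> E. v \<in> e}"
      then obtain w i where w: "e = {w, m i w}" "w \<in> C" "i \<in> {1..d}" "m i w \<noteq> w" "v \<in> e"
        by (auto simp: E_def)
      then have "e = {v, m i v}" "m i v \<noteq> v" using mm by auto
      then show "e \<in> (\<lambda>i. {v, m i v}) ` ?I" using nf w(3) by blast
    next
      fix e assume "e \<in> (\<lambda>i. {v, m i v}) ` ?I"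
      then show "e \<in> {e \<in> E. v \<in> e}" using nf v unfolding E_def by blast
    qed
    moreover have "inj_on (\<lambda>i. {v, m i v}) ?I"
      using m_eqD[OF v] nf by (auto simp: inj_on_def doubleton_eq_iff)
    ultimately have "card {e \<in> E. v \<in> e} = card ?I" by (simp add: card_image)
    then show ?thesis using cK[OF v] by (simp add: valency_def G_def)
  qed
  then have reg: "regular (d - 1) G" by (simp add: regular_def G_def)
  define col where "col e = (THE i. i \<in> {1..d} \<and> (\<exists>v\<in>C. e = {v, m i v}))" for e
  have col: "col {v, m i v} = i" if "v \<in> C" "i \<in> {1..d}" "m i v \<noteq> v" for i v
    unfolding col_def
  proof (rule the_equality)
    fix j assume "j \<in> {1..d} \<and> (\<exists>w\<in>C. {v, m i v} = {w, m j w})"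
    then obtain w where j: "j \<in> {1..d}" "w \<in> C" "{v, m i v} = {w, m j w}" by blast
    \<comment> \<open>Either \<open>w = v\<close>, or \<open>w = m i v\<close> and
      \<open>m j w = v\<close>; in the second case \<open>m j\<close> is applied once more. Hence
      the color of an edge is unique.\<close>
    then have "m i v = m j v" using mm[OF j(1)] by (auto simp: doubleton_eq_iff)
    then show "j = i" using m_eqD[OF that(1,2) j(1)] by simp
  qed (use that in blast)
  define f where "f e = (if e \<in> pendant_edges C then c e else col (Inl -` e))" for e :: "('a + 'a) set"
  have f_pend: "f (pendant_edge v) = c (pendant_edge v)" if "v \<in> C" for v
    using that by (simp add: f_def pendant_edges_def)
  have f_edge: "f (Inl ` e) = col e" for e
    by (auto simp: f_def pendant_edges_def inj_vimage_image_eq)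
  have edge: "col e \<in> {1..d} \<and> m (col e) v \<noteq> v \<and> e = {v, m (col e) v}"
    if e: "e \<in> E" "v \<in> e" for e v
  proof -
    obtain w i where w: "e = {w, m i w}" "w \<in> C" "i \<in> {1..d}" "m i w \<noteq> w"
      using e by (auto simp: E_def)
    then have "col e = i" using col by simp
    then show ?thesis using w e(2) mm by auto
  qed
  have ne: "\<exists>v. v \<in> e \<and> v \<in> C" if "e \<in> E" for e using that by (auto simp: E_def)
  have sub: "e \<subseteq> C" if "e \<in> E" for e using that mC by (auto simp: E_def)
  have "proper_edge_coloring (sun G) {1..d} f"
    unfolding proper_edge_coloring_def
  proof (intro conjI ballI impI)
    have "f e \<in> {1..d}" if "e \<in> edges (sun G)" for e
      using that edge ne cK by (fastforce simp: G_def f_edge f_pend pendant_edges_def)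
    then show "f \<in> edges (sun G) \<rightarrow> {1..d}" by blast
  next
    have pend_ne: "f (pendant_edge v) \<noteq> f (Inl ` e)" if "v \<in> C" "e \<in> E" "v \<in> e" for v e
      \<comment> \<open>The involution of the pendant color fixes \<open>v\<close>, that of the edge
        color moves it.\<close>
      using edge[OF that(2,3)] mc[OF that(1)] by (auto simp: f_edge f_pend[OF that(1)])
    fix e e' assume e: "e \<in> edges (sun G)" "e' \<in> edges (sun G)" "e \<noteq> e' \<and> e \<inter> e' \<noteq> {}"
    consider (ee) a b where "e = Inl ` a" "e' = Inl ` b" "a \<in> E" "b \<in> E"
      | (ep) a v where "e = Inl ` a" "e' = pendant_edge v" "a \<in> E" "v \<in> C"
      | (pe) a v where "e = pendant_edge v" "e' = Inl ` a" "a \<in> E" "v \<in> C"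
      | (pp) v w where "e = pendant_edge v" "e' = pendant_edge w"
      using e(1,2) by (auto simp: G_def pendant_edges_def)
    then show "f e \<noteq> f e'"
    proof cases
      case ee
      then obtain v where v: "v \<in> a" "v \<in> b" using e(3) by auto
      \<comment> \<open>Edges of equal color \<open>i\<close> through \<open>v\<close> would both be
        \<open>{v, m i v}\<close>.\<close>
      show ?thesis
        using edge[OF ee(3) v(1)] edge[OF ee(4) v(2)] e(3) ee(1,2) by (metis f_edge)
    next
      case ep
      then have "v \<in> a" using e(3) by (auto simp: pendant_edge_def)
      then show ?thesis using pend_ne[OF ep(4,3)] ep by metis
    next
      case pe
      then have "v \<in> a" using e(3) by (auto simp: pendant_edge_def)
      then show ?thesis using pend_ne[OF pe(4,3)] pe by metis
    next
      case pp
      then show ?thesis using e(3) by (auto simp: pendant_edge_def)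
    qed
  qed
  then have "pendant_coloring_extends G {1..d} c"
    unfolding pendant_coloring_extends_def
    by (intro exI[of _ f]) (auto simp: G_def f_def)
  then show ?thesis using simple reg by (auto simp: G_def)
qed

theorem theorem3p1:
  fixes d r :: nat and x :: "nat \<Rightarrow> nat" and C :: "'a set"
    and c :: "('a + 'a) set \<Rightarrow> nat"
  assumes "d \<ge> 1" and "r \<ge> d"
    and "(\<Sum>i=1..d. x i) = r"
    and "finite C" and "card C = r"
    and "c \<in> pendant_edges C \<rightarrow> {1..d}"
    and "\<forall>i\<in>{1..d}. card {e \<in> pendant_edges C. c e = i} = x i"
  defines "parity_condition \<equiv>
      (\<forall>i\<in>{1..d}. even (x i) \<longleftrightarrow> even r) \<and> (odd r \<longrightarrow> odd d)"
  shows "((\<exists>G. simple_graph G \<and> verts G = C \<and> regular (d - 1) G \<and>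
              pendant_coloring_extends G {1..d} c) \<longleftrightarrow> parity_condition)
    \<and> (\<forall>G. simple_graph G \<and> verts G = C \<and> regular (d - 1) G \<longrightarrow>
           (pendant_coloring_extends G {1..d} c \<longleftrightarrow> sun_class_one_with G c))
    \<and> (\<not> parity_condition \<longrightarrow>
         \<not> (\<exists>G. simple_graph G \<and> verts G = C \<and> regular (d - 1) G \<and>
               pendant_coloring_extends G {1..d} c))"
proof -
  have "C \<noteq> {}" using assms(1,2,5) by auto
  have x: "card {v \<in> C. c (pendant_edge v) = i} = x i" if "i \<in> {1..d}" for i
  proof -
    have "{e \<in> pendant_edges C. c e = i} = pendant_edge ` {v \<in> C. c (pendant_edge v) = i}"
      by (auto simp: pendant_edges_def)
    then have "card {e \<in> pendant_edges C. c e = i} = card {v \<in> C. c (pendant_edge v) = i}"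
      by (simp add: card_image inj_on_def)
    then show ?thesis using assms(7) that by simp
  qed
  have necessary: parity_condition
    if G: "simple_graph G" "verts G = C" "regular (d - 1) G" "pendant_coloring_extends G {1..d} c"
    for G
  proof -
    have par: "even (x i) \<longleftrightarrow> even r" if i: "i \<in> {1..d}" for i
    proof -
      have "C = {v \<in> C. c (pendant_edge v) = i} \<union> {v \<in> C. c (pendant_edge v) \<noteq> i}" by auto
      then have "r = card ({v \<in> C. c (pendant_edge v) = i} \<union> {v \<in> C. c (pendant_edge v) \<noteq> i})"
        using assms(5) by simp
      also have "\<dots> = x i + card {v \<in> C. c (pendant_edge v) \<noteq> i}"
        using assms(4) x[OF i] by (subst card_Un_disjoint) auto
      finally show ?thesis
        using even_card_other_pendant_color[OF G(1,3) assms(1) G(4) i] G(2) by simp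
    qed
    moreover have "odd d" if "odd r"
    proof -
      \<comment> \<open>All \<open>d\<close> summands of the odd number \<open>r\<close> are odd, so
        \<open>d\<close> is odd.\<close>
      have "{i \<in> {1..d}. odd (x i)} = {1..d}" using par that by blast
      then show ?thesis using that assms(3) even_sum_iff[of "{1..d}" x] by simp
    qed
    ultimately show ?thesis by (simp add: parity_condition_def)
  qed
  have sufficient: "\<exists>G. simple_graph G \<and> verts G = C \<and> regular (d - 1) G \<and>
      pendant_coloring_extends G {1..d} c" if par: parity_condition
  proof -
    have cK: "(\<lambda>v. c (pendant_edge v)) \<in> C \<rightarrow> {1..d}"
      using assms(6) by (auto simp: pendant_edges_def)
    obtain m where "sun_system {1..d} C m" "\<And>v. v \<in> C \<Longrightarrow> m (c (pendant_edge v)) v = v"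
      by (rule exists_sun_system[OF assms(4) _ _ _ cK])
        (use assms(1,2,5) par x in \<open>auto simp: parity_condition_def\<close>)
    then show ?thesis using sun_system_graph[OF assms(4,1) _ assms(6)] by blast
  qed
  show ?thesis
    using necessary sufficient extends_iff_class_one \<open>C \<noteq> {}\<close> assms(1) by blast
qed

end
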